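(* Let $\{M^n\}_{n\ge 1}$, $M^n=(F^n,W^n,\alpha^n)$, be a sequence of random assignment markets with $|F^n|=n$ firms and $|W^n|=n+k(n)$ workers, where $k(n)\ge 0$ is an integer for each $n$, and where the entries of $\alpha^n$ are i.i.d. with cdf $G$ supported on $[0,1]$ having a density $g$ that is continuous and strictly positive on $[0,1]$. Then there exists a constant $c\in\mathbb{R}_+$ (not depending on $n$) such that with probability at least $1-O\left(\frac1n\right)$ the following holds: for every core allocation $(\mu,u,v)\in C(M^n)$, (1) for all $i,j\in\{1,\dots,|F^n|\}$: $|u_i-u_j|\le \frac{c\log^2 n}{n}$; and (2) for all $i,j\in\{1,\dots,|W^n|\}$: $|v_i-v_j|\le \frac{c\log^2 n}{n}$.
   Context: A market is $M^n=(F^n,W^n,\alpha^n)$, where $F^n$ is a finite set of firms, $W^n$ a finite set of workers, and $\alpha^n$ is an $|F^n|\times|W^n|$ real matrix; $\alpha^n_{f,w}$ is the value produced by the pair $(f,w)$. The value of a coalition $S\subseteq F^n\cup W^n$ is $\mathrm{v}(S)=\max[\alpha^n_{i_1j_1}+\dots+\alpha^n_{i_lj_l}]$, the maximum over all choices of $2l$ distinct agents $i_1,\dots,i_l\in S\cap F^n$, $j_1,\dots,j_l\in S\cap W^n$, $l\le\min\{|S\cap F^n|,|S\cap W^n|\}$. An allocation is a triple $(\mu,u,v)$, where $\mu$ is a (one-to-one, possibly partial) matching of firms and workers, and $u=(u_f)_{f\in F^n}$ (profits) and $v=(v_w)_{w\in W^n}$ (salaries) are real payoff vectors. Utility is linear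 in money and transfers between any agents are allowed, so feasibility means $\sum_f u_f+\sum_w v_w=\sum_{f:\mu(f)\ne\emptyset}\alpha^n_{f,\mu(f)}$. It is a core allocation if no coalition can deviate and split its value so that all its members become strictly better off, i.e. $\sum_{f\in S\cap F^n}u_f+\sum_{w\in S\cap W^n}v_w\ge \mathrm{v}(S)$ for every coalition $S$. $C(M^n)$ denotes the set of core allocations. (Equivalently: $u,v\ge0$, $u_f+v_w\ge\alpha^n_{f,w}$ for all $f,w$, with equality for matched pairs, and unmatched agents get $0$.) Firms are indexed $1,\dots,|F^n|$ and workers $1,\dots,|W^n|$. The $O(\cdot)$ is as $n\to\infty$, with an implied constant independent of $n$. *)

theory Defs
  imports "HOL-Probability.Probability" "HOL-Library.Landau_Symbols"
begin

text \<open>Firms \<open>F\<close> and workers \<open>W\<close> are meant to be finite; a (possibly partial) one-to-one matching is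
  represented by its set of matched pairs.\<close>

definition matchings :: "'f set \<Rightarrow> 'w set \<Rightarrow> ('f \<times> 'w) set set" where
  "matchings F W = {\<mu>. \<mu> \<subseteq> F \<times> W \<and> inj_on fst \<mu> \<and> inj_on snd \<mu>}"

definition matching_value :: "('f \<Rightarrow> 'w \<Rightarrow> real) \<Rightarrow> ('f \<times> 'w) set \<Rightarrow> real" where
  "matching_value \<alpha> \<mu> = (\<Sum>(f, w)\<in>\<mu>. \<alpha> f w)"

text \<open>The agents are the elements of the disjoint union \<open>F <+> W\<close>, and coalitions are subsets of it.\<close>

definition coalition_firms :: "('f + 'w) set \<Rightarrow> 'f set" where
  "coalition_firms S = Inl -` S"

definition coalition_workers :: "('f + 'w) set \<Rightarrow> 'w set" where
  "coalition_workers S = Inr -` S"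

text \<open>The empty choice of pairs is admitted, so that a coalition with members on one side of the
  market only has value 0.\<close>

definition coalition_value :: "('f \<Rightarrow> 'w \<Rightarrow> real) \<Rightarrow> ('f + 'w) set \<Rightarrow> real" where
  "coalition_value \<alpha> S =
     Max (matching_value \<alpha> ` matchings (coalition_firms S) (coalition_workers S))"

text \<open>Payoff vectors are total functions; only their values on \<open>F\<close> and \<open>W\<close> matter.\<close>

definition allocations ::
  "'f set \<Rightarrow> 'w set \<Rightarrow> ('f \<Rightarrow> 'w \<Rightarrow> real) \<Rightarrow> (('f \<times> 'w) set \<times> ('f \<Rightarrow> real) \<times> ('w \<Rightarrow> real)) set"
  where
  "allocations F W \<alpha> =
     {(\<mu>, u, v). \<mu> \<in> matchings F W \<and> sum u F + sum v W = matching_value \<alpha> \<mu>}"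

definition core ::
  "'f set \<Rightarrow> 'w set \<Rightarrow> ('f \<Rightarrow> 'w \<Rightarrow> real) \<Rightarrow> (('f \<times> 'w) set \<times> ('f \<Rightarrow> real) \<times> ('w \<Rightarrow> real)) set"
  where
  "core F W \<alpha> =
     {(\<mu>, u, v). (\<mu>, u, v) \<in> allocations F W \<alpha> \<and>
        (\<forall>S. S \<subseteq> F <+> W \<longrightarrow>
           sum u (coalition_firms S) + sum v (coalition_workers S) \<ge> coalition_value \<alpha> S)}"

definition cdf_supported_on_unit_interval :: "(real \<Rightarrow> real) \<Rightarrow> bool" where
  "cdf_supported_on_unit_interval G \<longleftrightarrow> (\<forall>x<0. G x = 0) \<and> (\<forall>x\<ge>1. G x = 1)"

definition cdf_has_density :: "(real \<Rightarrow> real) \<Rightarrow> (real \<Rightarrow> real) \<Rightarrow> bool" where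
  "cdf_has_density G g \<longleftrightarrow>
     integrable lborel g \<and> (\<forall>x. 0 \<le> g x) \<and> (\<forall>x. G x = (LINT t:{..x}|lborel. g t))"

definition iid_with_cdf :: "'a measure \<Rightarrow> 'i set \<Rightarrow> ('i \<Rightarrow> 'a \<Rightarrow> real) \<Rightarrow> (real \<Rightarrow> real) \<Rightarrow> bool" where
  "iid_with_cdf M I X G \<longleftrightarrow>
     prob_space.indep_vars M (\<lambda>_. borel) X I \<and> (\<forall>i\<in>I. cdf (distr M borel (X i)) = G)"

end

theory Submission
  imports Defs
begin

text \<open>Let \<open>\<epsilon> = C ln n / n\<close> and join firm \<open>f\<close> and worker \<open>w\<close> if \<open>\<alpha> f w > 1 - \<epsilon>\<close>. Stability and
  \<open>\<alpha> \<le> 1\<close> show that the partner \<open>f'\<close> of a worker joined to \<open>f\<close> earns at most \<open>u f + \<epsilon>\<close>; a firm joined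
  to an unmatched worker earns at least \<open>1 - \<epsilon>\<close>. With probability \<open>1 - O(1/n\<^sup>2)\<close> the graph expands: every
  set of firms (or of workers) that is not too large has at least twice as many neighbours. Since the
  matching is injective, the level sets \<open>{f. u f \<le> u i + t \<epsilon>}\<close> and \<open>{f. u j \<le> u f + t \<epsilon>}\<close> double with each
  increment of \<open>t\<close>, so after \<open>O(ln n)\<close> steps both contain more than half of the firms and meet, which
  bounds \<open>u j - u i\<close> by \<open>O(\<epsilon> ln n)\<close>. If there are more than \<open>2 n\<close> workers, expansion of firm sets into the
  first \<open>2 n\<close> workers already leads to an unmatched worker, so that all firms earn \<open>1 - O(\<epsilon> ln n)\<close>.
  Salaries are then controlled by the profits.\<close>

section \<open>Core allocations\<close>

text \<open>A coalition is the same as a pair \<open>F'\<close>, \<open>W'\<close>, and the maximum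
  runs over a finite set containing the empty matching, so bounding it means bounding every matching
  inside the coalition. The core is thus cut out by a linear equation and finitely many weak linear
  inequalities, a form that serves both the stability argument and the closedness argument.\<close>

lemma core_iff:
  assumes "finite F" "finite W"
  shows "(\<mu>, u, v) \<in> core F W \<alpha> \<longleftrightarrow>
    \<mu> \<in> matchings F W \<and> sum u F + sum v W = matching_value \<alpha> \<mu> \<and>
    (\<forall>F'\<in>Pow F. \<forall>W'\<in>Pow W. \<forall>\<nu>\<in>matchings F' W'. matching_value \<alpha> \<nu> \<le> sum u F' + sum v W')"
proof -
  have fin: "finite (matchings F' W')" if "F' \<subseteq> F" "W' \<subseteq> W" for F' W'
  proof (rule finite_subset)
    show "matchings F' W' \<subseteq> Pow (F \<times> W)"
      using that by (auto simp: matchings_def)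
  qed (use assms in auto)
  have ne: "{} \<in> matchings F' W'" for F' :: "'a set" and W' :: "'b set"
    by (auto simp: matchings_def)
  have *: "coalition_value \<alpha> (F' <+> W') \<le> x \<longleftrightarrow> (\<forall>\<nu>\<in>matchings F' W'. matching_value \<alpha> \<nu> \<le> x)"
    if "F' \<subseteq> F" "W' \<subseteq> W" for F' W' x
  proof -
    have "coalition_firms (F' <+> W') = F'" "coalition_workers (F' <+> W') = W'"
      by (auto simp: coalition_firms_def coalition_workers_def)
    then show ?thesis
      unfolding coalition_value_def using fin[OF that] ne[of F' W'] by (subst Max_le_iff) auto
  qed
  have "(\<forall>S. S \<subseteq> F <+> W \<longrightarrow>
           sum u (coalition_firms S) + sum v (coalition_workers S) \<ge> coalition_value \<alpha> S) \<longleftrightarrow>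
    (\<forall>F'\<in>Pow F. \<forall>W'\<in>Pow W. \<forall>\<nu>\<in>matchings F' W'. matching_value \<alpha> \<nu> \<le> sum u F' + sum v W')"
    (is "?L \<longleftrightarrow> ?R")
  proof
    assume L: ?L
    show ?R
    proof (intro ballI)
      fix F' W' \<nu> assume A: "F' \<in> Pow F" "W' \<in> Pow W" "\<nu> \<in> matchings F' W'"
      have "coalition_firms (F' <+> W') = F'" "coalition_workers (F' <+> W') = W'"
        by (auto simp: coalition_firms_def coalition_workers_def)
      moreover have "F' <+> W' \<subseteq> F <+> W" using A by auto
      ultimately have "coalition_value \<alpha> (F' <+> W') \<le> sum u F' + sum v W'"
        using L by metis
      then show "matching_value \<alpha> \<nu> \<le> sum u F' + sum v W'"
        using A * by auto
    qed
  next
    assume R: ?R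
    show ?L
    proof (intro allI impI)
      fix S assume S: "S \<subseteq> F <+> W"
      have sub: "coalition_firms S \<subseteq> F" "coalition_workers S \<subseteq> W"
        using S by (auto simp: coalition_firms_def coalition_workers_def)
      have S': "coalition_firms S <+> coalition_workers S = S"
      proof (rule set_eqI)
        fix x show "(x \<in> coalition_firms S <+> coalition_workers S) = (x \<in> S)"
          by (cases x) (auto simp: coalition_firms_def coalition_workers_def)
      qed
      show "coalition_value \<alpha> S \<le> sum u (coalition_firms S) + sum v (coalition_workers S)"
        using *[OF sub] R sub unfolding S' by auto
    qed
  qed
  then show ?thesis
    unfolding core_def allocations_def by auto
qed

text \<open>The complementary slackness conditions of the assignment problem: \<open>u\<close>,
  \<open>v\<close> are feasible for the dual linear program and \<open>\<mu>\<close> is tight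
  against them. The growth arguments below use only such conditions on single agents and
  pairs.\<close>

locale stable_payoffs =
  fixes F :: "'f set" and W :: "'w set" and \<alpha> :: "'f \<Rightarrow> 'w \<Rightarrow> real"
    and \<mu> :: "('f \<times> 'w) set" and u :: "'f \<Rightarrow> real" and v :: "'w \<Rightarrow> real"
  assumes finite_firms: "finite F" and finite_workers: "finite W"
    and matching: "\<mu> \<in> matchings F W"
    and u_nonneg: "f \<in> F \<Longrightarrow> 0 \<le> u f"
    and v_nonneg: "w \<in> W \<Longrightarrow> 0 \<le> v w"
    and stable: "f \<in> F \<Longrightarrow> w \<in> W \<Longrightarrow> \<alpha> f w \<le> u f + v w"
    and matched: "(f, w) \<in> \<mu> \<Longrightarrow> u f + v w = \<alpha> f w"
    and unmatched_firm: "f \<in> F \<Longrightarrow> f \<notin> fst ` \<mu> \<Longrightarrow> u f = 0"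
    and unmatched_worker: "w \<in> W \<Longrightarrow> w \<notin> snd ` \<mu> \<Longrightarrow> v w = 0"

text \<open>Coalitions of one firm, of one worker and of one pair give the inequalities. By the
  budget equation the slacks \<open>d\<close> of the matched pairs and the payoffs of the unmatched
  agents, all nonnegative, add up to zero, so each of them vanishes.\<close>

lemma core_imp_stable_payoffs:
  assumes fin: "finite F" "finite W" and core: "(\<mu>, u, v) \<in> core F W \<alpha>"
  shows "stable_payoffs F W \<alpha> \<mu> u v"
proof -
  have \<mu>: "\<mu> \<in> matchings F W" and bal: "sum u F + sum v W = matching_value \<alpha> \<mu>"
    and coal: "\<And>F' W' \<nu>. F' \<subseteq> F \<Longrightarrow> W' \<subseteq> W \<Longrightarrow> \<nu> \<in> matchings F' W' \<Longrightarrow>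
       matching_value \<alpha> \<nu> \<le> sum u F' + sum v W'"
    using core core_iff[OF fin] by auto
  have \<mu>': "\<mu> \<subseteq> F \<times> W" "inj_on fst \<mu>" "inj_on snd \<mu>"
    using \<mu> by (auto simp: matchings_def)
  have fin\<mu>: "finite \<mu>" using \<mu>' fin by (meson finite_SigmaI finite_subset)
  have u0: "0 \<le> u f" if "f \<in> F" for f
    using coal[of "{f}" "{}" "{}"] that by (auto simp: matchings_def matching_value_def)
  have v0: "0 \<le> v w" if "w \<in> W" for w
    using coal[of "{}" "{w}" "{}"] that by (auto simp: matchings_def matching_value_def)
  have st: "\<alpha> f w \<le> u f + v w" if "f \<in> F" "w \<in> W" for f w
    using coal[of "{f}" "{w}" "{(f, w)}"] that by (auto simp: matchings_def matching_value_def)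
  have su: "sum u F = (\<Sum>x\<in>\<mu>. u (fst x)) + sum u (F - fst ` \<mu>)"
  proof -
    have "fst ` \<mu> \<subseteq> F" using \<mu>' by auto
    then have "sum u F = sum u (F - fst ` \<mu>) + sum u (fst ` \<mu>)"
      using fin(1) by (rule sum.subset_diff)
    then show ?thesis using sum.reindex[OF \<mu>'(2), of u] by simp
  qed
  have sv: "sum v W = (\<Sum>x\<in>\<mu>. v (snd x)) + sum v (W - snd ` \<mu>)"
  proof -
    have "snd ` \<mu> \<subseteq> W" using \<mu>' by auto
    then have "sum v W = sum v (W - snd ` \<mu>) + sum v (snd ` \<mu>)"
      using fin(2) by (rule sum.subset_diff)
    then show ?thesis using sum.reindex[OF \<mu>'(3), of v] by simp
  qed
  define d where "d x = u (fst x) + v (snd x) - \<alpha> (fst x) (snd x)" for x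
  have d0: "0 \<le> d x" if "x \<in> \<mu>" for x
    using st[of "fst x" "snd x"] that \<mu>'(1) unfolding d_def by auto
  have "sum d \<mu> + sum u (F - fst ` \<mu>) + sum v (W - snd ` \<mu>) = 0"
    using bal su sv
    by (simp add: d_def matching_value_def sum.distrib sum_subtractf case_prod_unfold)
  moreover have "0 \<le> sum d \<mu>" "0 \<le> sum u (F - fst ` \<mu>)" "0 \<le> sum v (W - snd ` \<mu>)"
    using d0 u0 v0 by (auto intro!: sum_nonneg)
  ultimately have z: "sum d \<mu> = 0" "sum u (F - fst ` \<mu>) = 0" "sum v (W - snd ` \<mu>) = 0"
    by linarith+
  have "\<forall>x\<in>\<mu>. d x = 0"
    using z(1) d0 fin\<mu> by (simp add: sum_nonneg_eq_0_iff)
  moreover have "\<forall>x\<in>F - fst ` \<mu>. u x = 0"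
    using z(2) u0 fin by (subst (asm) sum_nonneg_eq_0_iff) auto
  moreover have "\<forall>x\<in>W - snd ` \<mu>. v x = 0"
    using z(3) v0 fin by (subst (asm) sum_nonneg_eq_0_iff) auto
  ultimately show ?thesis
    by unfold_locales (use fin \<mu> u0 v0 st in \<open>auto simp: d_def\<close>)
qed

text \<open>Here \<open>r t\<close> stands for the size of a level set. The step is asked for every
  size \<open>s\<close> up to \<open>K\<close>, not only for \<open>r t\<close>, because a level set
  larger than \<open>K\<close> is expanded through a subset of size \<open>K\<close>; hence the
  growth saturates at \<open>2 * K\<close>.\<close>

lemma doubling:
  fixes r :: "nat \<Rightarrow> nat"
  assumes "1 \<le> r 0" and step: "\<And>t s. 1 \<le> s \<Longrightarrow> s \<le> r t \<Longrightarrow> s \<le> K \<Longrightarrow> 2 * s \<le> r (Suc t)"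
  shows "min (2 ^ t) (2 * K) \<le> r t"
proof (induction t)
  case 0
  then show ?case using assms(1) by simp
next
  case (Suc t)
  have "2 * min (r t) K \<le> r (Suc t)"
  proof (cases "min (r t) K = 0")
    case False
    then show ?thesis by (intro step) auto
  qed auto
  then show ?case using Suc by (auto simp: min_def split: if_splits)
qed

section \<open>Growth of profit level sets along the threshold graph\<close>

context stable_payoffs
begin

lemma matched_mem: "(f, w) \<in> \<mu> \<Longrightarrow> f \<in> F \<and> w \<in> W"
  using matching by (auto simp: matchings_def)

lemma card_partners_of_firms:
  assumes "S \<subseteq> fst ` \<mu>"
  shows "card (\<mu> `` S) = card S"
proof -
  define R where "R = {x \<in> \<mu>. fst x \<in> S}"
  have inj: "inj_on fst R" "inj_on snd R"
    using matching unfolding matchings_def R_def by (auto intro: inj_on_subset)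
  have "fst ` R = S" "snd ` R = \<mu> `` S"
    using assms unfolding R_def by force+
  then show ?thesis using card_image[OF inj(1)] card_image[OF inj(2)] by simp
qed

lemma card_partners_of_workers:
  assumes "S \<subseteq> snd ` \<mu>"
  shows "card (\<mu>\<inverse> `` S) = card S"
proof -
  define R where "R = {x \<in> \<mu>. snd x \<in> S}"
  have inj: "inj_on fst R" "inj_on snd R"
    using matching unfolding matchings_def R_def by (auto intro: inj_on_subset)
  have "snd ` R = S" "fst ` R = \<mu>\<inverse> `` S"
    using assms unfolding R_def by force+
  then show ?thesis using card_image[OF inj(1)] card_image[OF inj(2)] by simp
qed

text \<open>By counting, an unmatched firm leaves an unmatched worker. Both earn 0, so this pair
  would block as soon as its value is positive.\<close>

lemma all_firms_matched:
  assumes "card F \<le> card W" and pos: "\<And>f w. f \<in> F \<Longrightarrow> w \<in> W \<Longrightarrow> 0 < \<alpha> f w"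
  shows "fst ` \<mu> = F"
proof (rule ccontr)
  assume "fst ` \<mu> \<noteq> F"
  moreover have "fst ` \<mu> \<subseteq> F" "snd ` \<mu> \<subseteq> W" using matched_mem by force+
  ultimately obtain f where f: "f \<in> F" "f \<notin> fst ` \<mu>" by blast
  have "card (snd ` \<mu>) = card (fst ` \<mu>)"
    using matching by (auto simp: matchings_def card_image)
  also have "\<dots> < card F"
    using f \<open>fst ` \<mu> \<subseteq> F\<close> by (intro psubset_card_mono finite_firms) auto
  finally have "snd ` \<mu> \<noteq> W" using assms(1) by auto
  then obtain w where w: "w \<in> W" "w \<notin> snd ` \<mu>" using \<open>snd ` \<mu> \<subseteq> W\<close> by blast
  show False
    using stable[OF f(1) w(1)] pos[OF f(1) w(1)] unmatched_firm[OF f] unmatched_worker[OF w] by simp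
qed

lemma profit_le_1:
  assumes "\<And>f w. f \<in> F \<Longrightarrow> w \<in> W \<Longrightarrow> \<alpha> f w \<le> 1" and "f \<in> F"
  shows "u f \<le> 1"
proof (cases "f \<in> fst ` \<mu>")
  case True
  then obtain w where w: "(f, w) \<in> \<mu>" by auto
  then show ?thesis
    using matched[OF w] assms(1)[of f w] v_nonneg[of w] matched_mem[OF w] by auto
qed (use unmatched_firm assms in auto)

text \<open>Let \<open>w\<close> be a neighbour of \<open>f\<close>. If \<open>w\<close> is matched
  to \<open>f'\<close>, then \<open>u f' + v w \<le> 1 < \<alpha> f w + \<epsilon> \<le> u f + v w +
  \<epsilon>\<close>, so \<open>f'\<close> enters the next level set. If \<open>w\<close> is
  unmatched, its salary is 0 and \<open>u f\<close> exceeds \<open>1 - \<epsilon>\<close>; tracing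
  this back to \<open>i\<close> gives the first alternative. Neighbours are sought in a subset
  \<open>W'\<close> so that a very large worker side can be truncated.\<close>

lemma profit_spread_forward:
  assumes le1: "\<And>f w. f \<in> F \<Longrightarrow> w \<in> W \<Longrightarrow> \<alpha> f w \<le> 1" and "W' \<subseteq> W" "0 \<le> \<epsilon>"
    and expand: "\<And>S. S \<subseteq> F \<Longrightarrow> 1 \<le> card S \<Longrightarrow> card S \<le> K \<Longrightarrow>
      2 * card S \<le> card {w \<in> W'. \<exists>f\<in>S. 1 - \<epsilon> < \<alpha> f w}"
    and "i \<in> F" "2 * K \<le> 2 ^ L"
  shows "1 - real (L + 1) * \<epsilon> \<le> u i \<or> 2 * K \<le> card {f \<in> F. u f \<le> u i + real L * \<epsilon>}"
proof (rule disjCI)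
  define R where "R t = {f \<in> F. u f \<le> u i + real (min t L) * \<epsilon>}" for t :: nat
  assume "\<not> 2 * K \<le> card {f \<in> F. u f \<le> u i + real L * \<epsilon>}"
  then have small: "\<not> min (2 ^ L) (2 * K) \<le> card (R L)"
    using assms(6) by (simp add: R_def)
  have finR: "finite (R t)" for t using finite_firms by (auto simp: R_def)
  show "1 - real (L + 1) * \<epsilon> \<le> u i"
  proof (rule ccontr)
    assume neg: "\<not> ?thesis"
    \<comment> \<open>The cap in \<open>R\<close> is inactive for \<open>t \<le> L\<close>. The
      doubling step holds only below \<open>L\<close>, where \<open>neg\<close> rules out unmatched
      neighbours; \<open>doubling\<close> asks for it at every \<open>t\<close>, so the induction is
      carried out with the bound on \<open>t\<close>.\<close>
    have "min (2 ^ t) (2 * K) \<le> card (R t)" if "t \<le> L" for t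
      using that
    proof (induction t)
      case 0
      have "i \<in> R 0" using assms by (auto simp: R_def)
      then have "R 0 \<noteq> {}" by auto
      then have "1 \<le> card (R 0)" using finR[of 0] by (simp add: Suc_le_eq card_gt_0_iff)
      then show ?case by auto
    next
      case (Suc t)
      have t: "min t L = t" "min (Suc t) L = Suc t" using Suc.prems by auto
      have "2 * min (card (R t)) K \<le> card (R (Suc t))"
      proof (cases "min (card (R t)) K = 0")
        case False
        obtain S where S: "S \<subseteq> R t" "card S = min (card (R t)) K"
          by (meson min.cobounded1 obtain_subset_with_card_n)
        define N where "N = {w \<in> W'. \<exists>f\<in>S. 1 - \<epsilon> < \<alpha> f w}"
        have u_S: "u f \<le> u i + real t * \<epsilon>" "f \<in> F" if "f \<in> S" for f
          using that S t by (auto simp: R_def)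
        have "N \<subseteq> snd ` \<mu>"
        proof
          fix w assume w: "w \<in> N"
          then obtain f where f: "f \<in> S" "1 - \<epsilon> < \<alpha> f w" "w \<in> W" using assms by (auto simp: N_def)
          show "w \<in> snd ` \<mu>"
          proof (rule ccontr)
            assume "w \<notin> snd ` \<mu>"
            then have "1 - \<epsilon> < u f"
              using stable[OF u_S(2)[OF f(1)] f(3)] unmatched_worker[OF f(3)] f by simp
            then have "1 - real (t + 1) * \<epsilon> \<le> u i"
              using u_S(1)[OF f(1)] by (simp add: algebra_simps)
            moreover have "real (t + 1) * \<epsilon> \<le> real (L + 1) * \<epsilon>"
              using Suc.prems assms(3) by (intro mult_right_mono) auto
            ultimately show False using neg by linarith
          qed
        qed
        then have "card N = card (\<mu>\<inverse> `` N)" using card_partners_of_workers by simp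
        also have "\<dots> \<le> card (R (Suc t))"
        proof (intro card_mono finR subsetI)
          fix f' assume "f' \<in> \<mu>\<inverse> `` N"
          then obtain w where w: "w \<in> N" "(f', w) \<in> \<mu>" by auto
          then obtain f where f: "f \<in> S" "1 - \<epsilon> < \<alpha> f w" "w \<in> W" using assms by (auto simp: N_def)
          have f': "f' \<in> F" using matched_mem[OF w(2)] by simp
          have "u f' \<le> u f + \<epsilon>"
            using matched[OF w(2)] le1[OF f' f(3)] stable[OF u_S(2)[OF f(1)] f(3)] f(2) by linarith
          then show "f' \<in> R (Suc t)"
            using u_S(1)[OF f(1)] f' t by (auto simp: R_def algebra_simps)
        qed
        finally have "card N \<le> card (R (Suc t))" .
        moreover have "2 * card S \<le> card N"
          unfolding N_def using False S u_S by (intro expand) auto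
        ultimately show ?thesis using S by simp
      qed auto
      then show ?case using Suc by (auto simp: min_def split: if_splits)
    qed
    then show False using small by blast
  qed
qed

text \<open>The mirror image of the forward growth: pass first from the level set to the partners of
  its firms, which loses nothing since all firms are matched, and then to the neighbours of these
  workers. A neighbour of the partner of \<open>f'\<close> earns at least
  \<open>u f' - \<epsilon>\<close>.\<close>

lemma profit_spread_backward:
  assumes le1: "\<And>f w. f \<in> F \<Longrightarrow> w \<in> W \<Longrightarrow> \<alpha> f w \<le> 1" and all: "fst ` \<mu> = F"
    and expand: "\<And>S. S \<subseteq> W \<Longrightarrow> 1 \<le> card S \<Longrightarrow> card S \<le> K \<Longrightarrow>
      2 * card S \<le> card {f \<in> F. \<exists>w\<in>S. 1 - \<epsilon> < \<alpha> f w}"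
    and "j \<in> F" "2 * K \<le> 2 ^ L"
  shows "2 * K \<le> card {f \<in> F. u j \<le> u f + real L * \<epsilon>}"
proof -
  define R where "R t = {f \<in> F. u j \<le> u f + real t * \<epsilon>}" for t :: nat
  have finR: "finite (R t)" for t using finite_firms by (auto simp: R_def)
  have "min (2 ^ L) (2 * K) \<le> card (R L)"
  proof (rule doubling)
    have "j \<in> R 0" using assms by (auto simp: R_def)
    then have "R 0 \<noteq> {}" by auto
    then show "1 \<le> card (R 0)" using finR[of 0] by (simp add: Suc_le_eq card_gt_0_iff)
  next
    fix t s assume s: "1 \<le> s" "s \<le> card (R t)" "s \<le> K"
    obtain S where S: "S \<subseteq> R t" "card S = s"
      by (meson s obtain_subset_with_card_n)
    define N where "N = {f \<in> F. \<exists>w\<in>\<mu> `` S. 1 - \<epsilon> < \<alpha> f w}"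
    have "S \<subseteq> fst ` \<mu>" using S all by (auto simp: R_def)
    then have cardS: "card (\<mu> `` S) = s" using S card_partners_of_firms by simp
    have "2 * card (\<mu> `` S) \<le> card N"
      unfolding N_def using s cardS matched_mem by (intro expand) auto
    moreover have "card N \<le> card (R (Suc t))"
    proof (intro card_mono finR subsetI)
      fix f assume "f \<in> N"
      then obtain w f' where f: "f \<in> F" "1 - \<epsilon> < \<alpha> f w" "(f', w) \<in> \<mu>" "f' \<in> S"
        by (auto simp: N_def)
      have mem: "f' \<in> F" "w \<in> W" using matched_mem[OF f(3)] by auto
      have "u f' \<le> u f + \<epsilon>"
        using matched[OF f(3)] le1[OF mem] stable[OF f(1) mem(2)] f(2) by linarith
      then show "f \<in> R (Suc t)"
        using f S by (auto simp: R_def algebra_simps)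
    qed
    ultimately show "2 * s \<le> card (R (Suc t))" using cardS by simp
  qed
  then show ?thesis using assms(5) by (simp add: R_def)
qed

section \<open>Payoff spread in unbalanced and in nearly balanced markets\<close>

lemma salary_le:
  assumes le1: "\<And>f w. f \<in> F \<Longrightarrow> w \<in> W \<Longrightarrow> \<alpha> f w \<le> 1" and "0 \<le> \<delta>"
    and low: "\<And>f. f \<in> F \<Longrightarrow> 1 - \<delta> \<le> u f" and "w \<in> W"
  shows "v w \<le> \<delta>"
proof (cases "w \<in> snd ` \<mu>")
  case True
  then obtain f where f: "(f, w) \<in> \<mu>" by auto
  then show ?thesis
    using matched[OF f] le1[of f w] low[of f] matched_mem[OF f] by auto
qed (use unmatched_worker assms in auto)

text \<open>A level set of \<open>2 * K\<close> firms cannot exist when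
  \<open>card F < 2 * K\<close>, so the forward growth must end at an unmatched worker. All profits
  then lie within \<open>(L + 1) * \<epsilon>\<close> below 1 and all salaries within that distance
  above 0.\<close>

lemma payoff_spread_unbalanced:
  assumes le1: "\<And>f w. f \<in> F \<Longrightarrow> w \<in> W \<Longrightarrow> \<alpha> f w \<le> 1" and "W' \<subseteq> W" "0 \<le> \<epsilon>"
    and expand: "\<And>S. S \<subseteq> F \<Longrightarrow> 1 \<le> card S \<Longrightarrow> card S \<le> K \<Longrightarrow>
      2 * card S \<le> card {w \<in> W'. \<exists>f\<in>S. 1 - \<epsilon> < \<alpha> f w}"
    and "2 * K \<le> 2 ^ L" "card F < 2 * K"
  shows "(i \<in> F \<longrightarrow> j \<in> F \<longrightarrow> \<bar>u i - u j\<bar> \<le> real (L + 1) * \<epsilon>) \<and>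
    (i' \<in> W \<longrightarrow> j' \<in> W \<longrightarrow> \<bar>v i' - v j'\<bar> \<le> real (L + 1) * \<epsilon>)"
proof -
  have low: "1 - real (L + 1) * \<epsilon> \<le> u f" if "f \<in> F" for f
  proof -
    have "card {g \<in> F. u g \<le> u f + real L * \<epsilon>} \<le> card F"
      by (intro card_mono finite_firms) auto
    then show ?thesis
      using profit_spread_forward[OF le1 assms(2,3) expand that assms(5)] assms(6) by linarith
  qed
  have "v w \<le> real (L + 1) * \<epsilon>" if "w \<in> W" for w
    using salary_le[OF le1 _ low that] assms(3) by simp
  then show ?thesis
    using low profit_le_1[OF le1] v_nonneg by (auto simp: abs_le_iff) (smt (verit))+
qed

text \<open>Unless \<open>u i\<close> is already close to the upper bound 1, the forward set of
  \<open>i\<close> and the backward set of \<open>j\<close> each contain more than half of the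
  firms. A common firm links the two profits at a cost of \<open>2 * L\<close> increments.\<close>

lemma payoff_spread_balanced:
  assumes le1: "\<And>f w. f \<in> F \<Longrightarrow> w \<in> W \<Longrightarrow> \<alpha> f w \<le> 1" and all: "fst ` \<mu> = F" and "0 \<le> \<epsilon>"
    and expand_firms: "\<And>S. S \<subseteq> F \<Longrightarrow> 1 \<le> card S \<Longrightarrow> card S \<le> K \<Longrightarrow>
      2 * card S \<le> card {w \<in> W. \<exists>f\<in>S. 1 - \<epsilon> < \<alpha> f w}"
    and expand_workers: "\<And>S. S \<subseteq> W \<Longrightarrow> 1 \<le> card S \<Longrightarrow> card S \<le> K \<Longrightarrow>
      2 * card S \<le> card {f \<in> F. \<exists>w\<in>S. 1 - \<epsilon> < \<alpha> f w}"
    and "2 * K \<le> 2 ^ L" "card F < 4 * K"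
  shows "(i \<in> F \<longrightarrow> j \<in> F \<longrightarrow> \<bar>u i - u j\<bar> \<le> real (2 * L + 2) * \<epsilon>) \<and>
    (i' \<in> W \<longrightarrow> j' \<in> W \<longrightarrow> \<bar>v i' - v j'\<bar> \<le> real (2 * L + 2) * \<epsilon>)"
proof -
  have u: "u j \<le> u i + real (2 * L + 1) * \<epsilon>" if i: "i \<in> F" and j: "j \<in> F" for i j
  proof (cases "1 - real (L + 1) * \<epsilon> \<le> u i")
    case True
    moreover have "real (L + 1) * \<epsilon> \<le> real (2 * L + 1) * \<epsilon>"
      using assms(3) by (intro mult_right_mono) auto
    ultimately show ?thesis using profit_le_1[OF le1 j] by linarith
  next
    case False
    let ?R = "{f \<in> F. u f \<le> u i + real L * \<epsilon>}" and ?B = "{f \<in> F. u j \<le> u f + real L * \<epsilon>}"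
    have "2 * K \<le> card ?R"
      using profit_spread_forward[OF le1 _ assms(3) expand_firms i assms(6)] False by blast
    moreover have "2 * K \<le> card ?B"
      using profit_spread_backward[OF le1 all expand_workers j assms(6)] by blast
    moreover have "card (?R \<union> ?B) \<le> card F" by (intro card_mono finite_firms) auto
    ultimately have "card (?R \<union> ?B) < card ?R + card ?B" using assms(7) by linarith
    moreover have "finite ?R" "finite ?B" using finite_firms by auto
    ultimately have "?R \<inter> ?B \<noteq> {}"
      using card_Un_disjoint by fastforce
    then obtain f where "u f \<le> u i + real L * \<epsilon>" "u j \<le> u f + real L * \<epsilon>" by blast
    then have "u j \<le> u i + (2 * real L) * \<epsilon>" by (simp add: algebra_simps)
    moreover have "(2 * real L) * \<epsilon> \<le> real (2 * L + 1) * \<epsilon>"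
      using assms(3) by (intro mult_right_mono) auto
    ultimately show ?thesis by linarith
  qed
  \<comment> \<open>The salary \<open>v w\<close> is at most 1 minus the profit of the partner of
    \<open>w\<close>, while \<open>v w'\<close> exceeds \<open>1 - \<epsilon>\<close> minus the
    profit of any neighbour of \<open>w'\<close>. The profit bound thus carries over with one
    further \<open>\<epsilon>\<close>.\<close>
  have v: "v w \<le> v w' + real (2 * L + 2) * \<epsilon>" if w: "w \<in> W" "w' \<in> W" for w w'
  proof (cases "w \<in> snd ` \<mu>")
    case False
    then show ?thesis using unmatched_worker v_nonneg w assms(3) by simp
  next
    case True
    then obtain i where i: "(i, w) \<in> \<mu>" by auto
    \<comment> \<open>Expansion of a singleton provides the neighbour; \<open>K \<ge> 1\<close>
      follows from \<open>card F < 4 * K\<close>.\<close>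
    have "2 * card {w'} \<le> card {f \<in> F. \<exists>w\<in>{w'}. 1 - \<epsilon> < \<alpha> f w}"
      using w assms(7) by (intro expand_workers) auto
    then have "{f \<in> F. \<exists>w\<in>{w'}. 1 - \<epsilon> < \<alpha> f w} \<noteq> {}"
      by (intro notI) (simp only: card.empty, simp)
    then obtain f where f: "f \<in> F" "1 - \<epsilon> < \<alpha> f w'" by auto
    have "v w \<le> 1 - u i" using matched[OF i] le1 matched_mem[OF i] by smt
    moreover have "1 - \<epsilon> < u f + v w'" using stable[OF f(1) w(2)] f by linarith
    moreover have "u f \<le> u i + real (2 * L + 1) * \<epsilon>" using u f matched_mem[OF i] by auto
    ultimately show ?thesis by (simp add: algebra_simps)
  qed
  have "real (2 * L + 1) * \<epsilon> \<le> real (2 * L + 2) * \<epsilon>"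
    using assms(3) by (intro mult_right_mono) auto
  then show ?thesis
    using u v by (smt (verit))
qed

end

section \<open>Measurability\<close>

text \<open>Projection along a compact factor is a closed map, applied to the trace of
  \<open>C\<close> on \<open>UNIV \<times> K\<close>. This removes the uncountable existential
  quantifier over payoffs.\<close>

lemma closed_projection_of_compact:
  fixes K :: "'b::topological_space set" and C :: "('a::topological_space \<times> 'b) set"
  assumes K: "compact K" and C: "closed C"
  shows "closed {x. \<exists>y\<in>K. (x, y) \<in> C}"
proof -
  have "closed_map (prod_topology euclidean (subtopology euclidean K)) euclidean (fst :: 'a \<times> 'b \<Rightarrow> 'a)"
    using K by (intro Abstract_Topological_Spaces.closed_map_fst)
      (simp add: compact_space_subtopology)
  moreover have "prod_topology euclidean (subtopology euclidean K) =
      subtopology (euclidean :: ('a \<times> 'b) topology) (UNIV \<times> K)"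
    by (simp add: prod_topology_subtopology)
  moreover have "closedin (subtopology euclidean (UNIV \<times> K)) (C \<inter> (UNIV \<times> K))"
    using C by (auto simp: closedin_closed)
  ultimately have "closedin euclidean (fst ` (C \<inter> (UNIV \<times> K)))"
    by (auto simp: closed_map_def)
  moreover have "fst ` (C \<inter> (UNIV \<times> K)) = {x. \<exists>y\<in>K. (x, y) \<in> C}"
    by force
  ultimately show ?thesis by simp
qed

text \<open>Values and payoffs are total functions. This permits resetting them to 0 outside the
  market, which is what makes the relevant payoff sets compact.\<close>

lemma core_cong:
  assumes "finite F" "finite W"
    and \<alpha>: "\<And>f w. f \<in> F \<Longrightarrow> w \<in> W \<Longrightarrow> \<alpha> f w = \<alpha>' f w"
    and u: "\<And>f. f \<in> F \<Longrightarrow> u f = u' f" and v: "\<And>w. w \<in> W \<Longrightarrow> v w = v' w"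
  shows "(\<mu>, u, v) \<in> core F W \<alpha> \<longleftrightarrow> (\<mu>, u', v') \<in> core F W \<alpha>'"
proof -
  have val: "matching_value \<alpha> \<nu> = matching_value \<alpha>' \<nu>" if "\<nu> \<in> matchings F' W'" "F' \<subseteq> F" "W' \<subseteq> W"
    for \<nu> F' W'
    unfolding matching_value_def case_prod_unfold
  proof (intro sum.cong refl \<alpha>)
    fix x assume "x \<in> \<nu>"
    then have "x \<in> F \<times> W" using that unfolding matchings_def by blast
    then show "fst x \<in> F" "snd x \<in> W" by auto
  qed
  have su: "sum u F' = sum u' F'" if "F' \<subseteq> F" for F' using that u by (intro sum.cong) auto
  have sv: "sum v W' = sum v' W'" if "W' \<subseteq> W" for W' using that v by (intro sum.cong) auto
  have "(\<forall>F'\<in>Pow F. \<forall>W'\<in>Pow W. \<forall>\<nu>\<in>matchings F' W'. matching_value \<alpha> \<nu> \<le> sum u F' + sum v W') \<longleftrightarrow>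
    (\<forall>F'\<in>Pow F. \<forall>W'\<in>Pow W. \<forall>\<nu>\<in>matchings F' W'. matching_value \<alpha>' \<nu> \<le> sum u' F' + sum v' W')"
  proof (intro ball_cong refl)
    fix F' W' \<nu> assume "F' \<in> Pow F" "W' \<in> Pow W" "\<nu> \<in> matchings F' W'"
    then show "matching_value \<alpha> \<nu> \<le> sum u F' + sum v W' \<longleftrightarrow> matching_value \<alpha>' \<nu> \<le> sum u' F' + sum v' W'"
      using val[of \<nu> F' W'] su[of F'] sv[of W'] by simp
  qed
  then show ?thesis
    unfolding core_iff[OF assms(1,2)] using val[of \<mu> F W] su[of F] sv[of W] by auto
qed

lemma continuous_on_apply [continuous_intros]:
  assumes "continuous_on S f"
  shows "continuous_on S (\<lambda>x. f x i)"
  using continuous_on_product_then_coordinatewise[OF assms] .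

text \<open>The core correspondence is closed and locally bounded, so for closed \<open>D\<close> the set of
  value matrices having a core allocation with payoffs in \<open>D\<close> is a countable union of closed sets.\<close>

lemma core_hits_closed_measurable:
  fixes F :: "'f::countable set" and W :: "'w::countable set" and \<alpha> :: "'f \<Rightarrow> 'w \<Rightarrow> 'a \<Rightarrow> real"
  assumes fin: "finite F" "finite W"
    and meas: "\<And>f w. f \<in> F \<Longrightarrow> w \<in> W \<Longrightarrow> \<alpha> f w \<in> borel_measurable M"
    and D: "closed D"
    and D_cong: "\<And>u v u' v'. (\<And>f. f \<in> F \<Longrightarrow> u f = u' f) \<Longrightarrow> (\<And>w. w \<in> W \<Longrightarrow> v w = v' w) \<Longrightarrow>
      (u, v) \<in> D \<Longrightarrow> (u', v') \<in> D"
  shows "{\<omega> \<in> space M. \<exists>(\<mu>, u, v)\<in>core F W (\<lambda>f w. \<alpha> f w \<omega>). (u, v) \<in> D} \<in> sets M"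
proof -
  define X where "X \<omega> i = (if i \<in> F \<times> W then \<alpha> (fst i) (snd i) \<omega> else 0)" for \<omega> i
  \<comment> \<open>Core payoffs are nonnegative and bounded by their total, so after resetting to 0
    outside the market they lie in some box \<open>K N\<close>. The factors \<open>{0}\<close> keep
    the box compact even when the agent types are infinite.\<close>
  define K :: "nat \<Rightarrow> (('f \<Rightarrow> real) \<times> ('w \<Rightarrow> real)) set" where
    "K N = (PiE UNIV (\<lambda>f. if f \<in> F then {0..real N} else {0})) \<times>
           (PiE UNIV (\<lambda>w. if w \<in> W then {0..real N} else {0}))" for N
  define C :: "('f \<times> 'w) set \<Rightarrow> (('f \<times> 'w \<Rightarrow> real) \<times> ('f \<Rightarrow> real) \<times> ('w \<Rightarrow> real)) set" where
    "C \<mu> = {(a, u, v). (\<mu>, u, v) \<in> core F W (curry a) \<and> (u, v) \<in> D}" for \<mu>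
  \<comment> \<open>Countability of the agent types enters here: coordinatewise measurability then
    implies Borel measurability in the function space.\<close>
  have X [measurable]: "X \<in> borel_measurable M"
  proof (rule measurable_coordinatewise_then_product)
    fix i show "(\<lambda>\<omega>. X \<omega> i) \<in> borel_measurable M"
      using meas by (cases "i \<in> F \<times> W") (auto simp: X_def)
  qed
  have cpt: "compact (PiE UNIV (\<lambda>i. if i \<in> I then {0..real N} else {0::real}))" for I :: "'i set" and N
  proof -
    have "compactin (product_topology (\<lambda>i. euclidean) UNIV)
       (PiE UNIV (\<lambda>i. if i \<in> I then {0..real N} else {0::real}))"
      unfolding compactin_PiE by auto
    then show ?thesis by (simp add: euclidean_product_topology)
  qed
  have "compact (K N)" for N unfolding K_def by (intro compact_Times cpt)
  moreover have "closed (C \<mu>)" for \<mu>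
  proof (cases "\<mu> \<in> matchings F W")
    case True
    have "C \<mu> = {x. sum (fst (snd x)) F + sum (snd (snd x)) W = matching_value (curry (fst x)) \<mu>} \<inter>
       (\<Inter>F'\<in>Pow F. \<Inter>W'\<in>Pow W. \<Inter>\<nu>\<in>matchings F' W'.
          {x. matching_value (curry (fst x)) \<nu> \<le> sum (fst (snd x)) F' + sum (snd (snd x)) W'}) \<inter>
       snd -` D"
      using True by (auto simp: C_def core_iff[OF fin])
    moreover have "closed (snd -` D :: (('f \<times> 'w \<Rightarrow> real) \<times> ('f \<Rightarrow> real) \<times> ('w \<Rightarrow> real)) set)"
      using D by (intro closed_vimage continuous_intros)
    moreover have "continuous_on UNIV (\<lambda>x :: ('f \<times> 'w \<Rightarrow> real) \<times> ('f \<Rightarrow> real) \<times> ('w \<Rightarrow> real).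
      matching_value (curry (fst x)) \<nu>)"
      for \<nu>
      unfolding matching_value_def curry_def case_prod_unfold by (intro continuous_intros)
    moreover have "continuous_on UNIV (\<lambda>x :: ('f \<times> 'w \<Rightarrow> real) \<times> ('f \<Rightarrow> real) \<times> ('w \<Rightarrow> real).
      sum (fst (snd x)) F' + sum (snd (snd x)) W')"
      for F' W'
      by (intro continuous_intros)
    ultimately show ?thesis
      by (simp only:) (intro closed_Int closed_INT closed_Collect_eq closed_Collect_le ballI)
  next
    case False
    then have "C \<mu> = {}" by (auto simp: C_def core_iff[OF fin])
    then show ?thesis by simp
  qed
  ultimately have "closed {a. \<exists>y\<in>K N. (a, y) \<in> C \<mu>}" for N \<mu>
    by (rule closed_projection_of_compact)
  then have cl: "{a. \<exists>y\<in>K N. (a, y) \<in> C \<mu>} \<in> sets borel" for N \<mu> by (rule borel_closed)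
  have eq: "{\<omega> \<in> space M. \<exists>(\<mu>, u, v)\<in>core F W (\<lambda>f w. \<alpha> f w \<omega>). (u, v) \<in> D} =
    (\<Union>\<mu>\<in>matchings F W. \<Union>N. X -` {a. \<exists>y\<in>K N. (a, y) \<in> C \<mu>} \<inter> space M)" (is "?L = ?R")
  proof (intro set_eqI iffI)
    fix \<omega> assume "\<omega> \<in> ?L"
    then obtain \<mu> u v where \<omega>: "\<omega> \<in> space M" and core: "(\<mu>, u, v) \<in> core F W (\<lambda>f w. \<alpha> f w \<omega>)"
      and uv: "(u, v) \<in> D" by auto
    interpret stable_payoffs F W "\<lambda>f w. \<alpha> f w \<omega>" \<mu> u v
      by (rule core_imp_stable_payoffs[OF fin core])
    define u' where "u' f = (if f \<in> F then u f else 0)" for f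
    define v' where "v' w = (if w \<in> W then v w else 0)" for w
    obtain N where N: "sum u F + sum v W \<le> real N" using real_arch_simple by blast
    have "0 \<le> sum u F" "0 \<le> sum v W" using u_nonneg v_nonneg by (auto intro: sum_nonneg)
    moreover have "u f \<le> sum u F" if "f \<in> F" for f
      using that fin u_nonneg by (intro member_le_sum) auto
    moreover have "v w \<le> sum v W" if "w \<in> W" for w
      using that fin v_nonneg by (intro member_le_sum) auto
    ultimately have "(u', v') \<in> K N"
      using N u_nonneg v_nonneg by (fastforce simp: K_def u'_def v'_def)
    moreover have "(\<mu>, u', v') \<in> core F W (curry (X \<omega>))"
      using core by (subst core_cong[OF fin, of _ "\<lambda>f w. \<alpha> f w \<omega>" _ u _ v]) 
        (auto simp: u'_def v'_def X_def)
    moreover have "(u', v') \<in> D"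
      by (rule D_cong[OF _ _ uv]) (auto simp: u'_def v'_def)
    ultimately have "X \<omega> \<in> {a. \<exists>y\<in>K N. (a, y) \<in> C \<mu>}" by (auto simp: C_def)
    then show "\<omega> \<in> ?R" using \<omega> matching by blast
  next
    fix \<omega> assume "\<omega> \<in> ?R"
    then obtain \<mu> u v where "\<omega> \<in> space M" "(\<mu>, u, v) \<in> core F W (curry (X \<omega>))" "(u, v) \<in> D"
      by (auto simp: C_def)
    moreover from this have "(\<mu>, u, v) \<in> core F W (\<lambda>f w. \<alpha> f w \<omega>)"
      by (subst core_cong[OF fin, of _ "curry (X \<omega>)" _ u _ v]) (auto simp: X_def)
    ultimately show "\<omega> \<in> ?L" by auto
  qed
  have "finite (matchings F W)"
    using fin by (auto simp: matchings_def intro: finite_subset[of _ "Pow (F \<times> W)"])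
  moreover have "(\<Union>N. X -` {a. \<exists>y\<in>K N. (a, y) \<in> C \<mu>} \<inter> space M) \<in> sets M" for \<mu>
    using measurable_sets[OF X cl] by (intro sets.countable_UN) blast
  ultimately show ?thesis unfolding eq by (rule sets.finite_UN)
qed

text \<open>Since \<open>measure\<close> is 0 on non-measurable sets, the probability bound has no
  content without this. The complement asks for a core allocation with some difference above
  \<open>c\<close>; this strict inequality is a countable union of the closed conditions
  \<open>c + inverse (real (Suc m)) \<le> x\<close>.\<close>

lemma core_payoff_spread_measurable:
  fixes F :: "'f::countable set" and W :: "'w::countable set" and \<alpha> :: "'f \<Rightarrow> 'w \<Rightarrow> 'a \<Rightarrow> real"
  assumes fin: "finite F" "finite W"
    and meas: "\<And>f w. f \<in> F \<Longrightarrow> w \<in> W \<Longrightarrow> \<alpha> f w \<in> borel_measurable M"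
  shows "{\<omega> \<in> space M. \<forall>(\<mu>, u, v) \<in> core F W (\<lambda>f w. \<alpha> f w \<omega>).
      (\<forall>i\<in>F. \<forall>j\<in>F. \<bar>u i - u j\<bar> \<le> c) \<and> (\<forall>i\<in>W. \<forall>j\<in>W. \<bar>v i - v j\<bar> \<le> c)} \<in> sets M"
proof -
  define hit where
    "hit D = {\<omega> \<in> space M. \<exists>(\<mu>, u, v)\<in>core F W (\<lambda>f w. \<alpha> f w \<omega>). (u, v) \<in> D}" for D
  define DF where "DF i j m = {(u :: 'f \<Rightarrow> real, v :: 'w \<Rightarrow> real). c + inverse (real (Suc m)) \<le> \<bar>u i - u j\<bar>}" for i j m
  define DW where "DW i j m = {(u :: 'f \<Rightarrow> real, v :: 'w \<Rightarrow> real). c + inverse (real (Suc m)) \<le> \<bar>v i - v j\<bar>}" for i j m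
  have cl: "closed (DF i j m)" "closed (DW i' j' m)" for i j i' j' m
    unfolding DF_def DW_def case_prod_unfold by (intro closed_Collect_le continuous_intros)+
  have F: "hit (DF i j m) \<in> sets M" if "i \<in> F" "j \<in> F" for i j m
    unfolding hit_def using that
    by (intro core_hits_closed_measurable[OF fin meas cl(1)]) (auto simp: DF_def)
  have W: "hit (DW i j m) \<in> sets M" if "i \<in> W" "j \<in> W" for i j m
    unfolding hit_def using that
    by (intro core_hits_closed_measurable[OF fin meas cl(2)]) (auto simp: DW_def)
  have UN_F: "(\<Union>m. hit (DF i j m)) \<in> sets M" if "i \<in> F" "j \<in> F" for i j
    using F[OF that] by (intro sets.countable_UN) blast
  have UN_W: "(\<Union>m. hit (DW i j m)) \<in> sets M" if "i \<in> W" "j \<in> W" for i j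
    using W[OF that] by (intro sets.countable_UN) blast
  have gap: "c < x \<longleftrightarrow> (\<exists>m. c + inverse (real (Suc m)) \<le> x)" for x :: real
  proof
    assume "c < x"
    then obtain m where "inverse (real (Suc m)) < x - c" using reals_Archimedean[of "x - c"] by auto
    then show "\<exists>m. c + inverse (real (Suc m)) \<le> x" by (intro exI[of _ m]) simp
  next
    assume "\<exists>m. c + inverse (real (Suc m)) \<le> x"
    then obtain m where "c + inverse (real (Suc m)) \<le> x" by blast
    moreover have "0 < inverse (real (Suc m))" by simp
    ultimately show "c < x" by linarith
  qed
  have "{\<omega> \<in> space M. \<forall>(\<mu>, u, v) \<in> core F W (\<lambda>f w. \<alpha> f w \<omega>).
      (\<forall>i\<in>F. \<forall>j\<in>F. \<bar>u i - u j\<bar> \<le> c) \<and> (\<forall>i\<in>W. \<forall>j\<in>W. \<bar>v i - v j\<bar> \<le> c)} =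
    space M - ((\<Union>i\<in>F. \<Union>j\<in>F. \<Union>m. hit (DF i j m)) \<union> (\<Union>i\<in>W. \<Union>j\<in>W. \<Union>m. hit (DW i j m)))"
    (is "?L = space M - ?R")
  proof (intro set_eqI iffI)
    fix \<omega> assume \<omega>: "\<omega> \<in> ?L"
    have "\<omega> \<notin> hit (DF i j m)" if "i \<in> F" "j \<in> F" for i j m
    proof
      assume "\<omega> \<in> hit (DF i j m)"
      then obtain \<mu> u v where core: "(\<mu>, u, v) \<in> core F W (\<lambda>f w. \<alpha> f w \<omega>)"
        and "c + inverse (real (Suc m)) \<le> \<bar>u i - u j\<bar>"
        unfolding hit_def DF_def by blast
      then have "c < \<bar>u i - u j\<bar>" using gap by blast
      then show False using \<omega> core that by fastforce
    qed
    moreover have "\<omega> \<notin> hit (DW i j m)" if "i \<in> W" "j \<in> W" for i j m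
    proof
      assume "\<omega> \<in> hit (DW i j m)"
      then obtain \<mu> u v where core: "(\<mu>, u, v) \<in> core F W (\<lambda>f w. \<alpha> f w \<omega>)"
        and "c + inverse (real (Suc m)) \<le> \<bar>v i - v j\<bar>"
        unfolding hit_def DW_def by blast
      then have "c < \<bar>v i - v j\<bar>" using gap by blast
      then show False using \<omega> core that by fastforce
    qed
    ultimately show "\<omega> \<in> space M - ?R" using \<omega> by blast
  next
    fix \<omega> assume "\<omega> \<in> space M - ?R"
    then have \<omega>: "\<omega> \<in> space M" and nF: "\<And>i j m. i \<in> F \<Longrightarrow> j \<in> F \<Longrightarrow> \<omega> \<notin> hit (DF i j m)"
      and nW: "\<And>i j m. i \<in> W \<Longrightarrow> j \<in> W \<Longrightarrow> \<omega> \<notin> hit (DW i j m)"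
      by auto
    have "\<bar>u i - u j\<bar> \<le> c" if core: "(\<mu>, u, v) \<in> core F W (\<lambda>f w. \<alpha> f w \<omega>)" and "i \<in> F" "j \<in> F"
      for \<mu> u v i j
    proof (rule ccontr)
      assume "\<not> ?thesis"
      then have "c < \<bar>u i - u j\<bar>" by simp
      then obtain m where "(u, v) \<in> DF i j m" unfolding gap DF_def by blast
      then have "\<omega> \<in> hit (DF i j m)" using core \<omega> by (auto simp: hit_def)
      then show False using nF that by blast
    qed
    moreover have "\<bar>v i - v j\<bar> \<le> c"
      if core: "(\<mu>, u, v) \<in> core F W (\<lambda>f w. \<alpha> f w \<omega>)" and "i \<in> W" "j \<in> W"
      for \<mu> u v i j
    proof (rule ccontr)
      assume "\<not> ?thesis"
      then have "c < \<bar>v i - v j\<bar>" by simp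
      then obtain m where "(u, v) \<in> DW i j m" unfolding gap DW_def by blast
      then have "\<omega> \<in> hit (DW i j m)" using core \<omega> by (auto simp: hit_def)
      then show False using nW that by blast
    qed
    ultimately show "\<omega> \<in> ?L" using \<omega> by auto
  qed
  also have "\<dots> \<in> sets M"
    by (intro sets.compl_sets sets.Un sets.finite_UN[OF fin(1)] sets.finite_UN[OF fin(2)] UN_F UN_W)
  finally show ?thesis .
qed

section \<open>Expansion of random bipartite graphs\<close>

lemma (in prob_space) indep_vars_prob_all_le:
  fixes X :: "'i \<Rightarrow> 'a \<Rightarrow> real"
  assumes indep: "indep_vars (\<lambda>_. borel) X I" and J: "J \<subseteq> I" "finite J"
    and p: "\<And>i. i \<in> J \<Longrightarrow> cdf (distr M borel (X i)) t \<le> p"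
  shows "prob {\<omega> \<in> space M. \<forall>i\<in>J. X i \<omega> \<le> t} \<le> p ^ card J"
\<comment> \<open>The product formula is for nonempty index sets; for empty \<open>J\<close> both
  sides equal 1.\<close>
proof (cases "J = {}")
  case True
  then show ?thesis by (simp add: prob_space)
next
  case False
  have rv: "random_variable borel (X i)" if "i \<in> J" for i
    using indep J that by (auto simp: indep_vars_def)
  have "{\<omega> \<in> space M. \<forall>i\<in>J. X i \<omega> \<le> t} = (\<Inter>i\<in>J. X i -` {..t} \<inter> space M)"
    using False by auto
  also have "prob \<dots> = (\<Prod>i\<in>J. prob (X i -` {..t} \<inter> space M))"
    by (rule indep_varsD[OF indep False J(2,1)]) auto
  also have "\<dots> \<le> (\<Prod>i\<in>J. p)"
    using p rv by (intro prod_mono) (auto simp: cdf_def2 measure_distr)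
  finally show ?thesis by simp
qed

text \<open>If a set \<open>S\<close> has fewer than \<open>2 * card S\<close> neighbours, then there is no edge between \<open>S\<close> and
  the complement of some set of size exactly \<open>2 * card S\<close>; the union bound runs over such pairs.\<close>

lemma (in prob_space) random_graph_expansion:
  fixes E :: "'b \<Rightarrow> 'c \<Rightarrow> 'a \<Rightarrow> bool"
  assumes fin: "finite A" "finite B" and card: "card A \<le> N" "card B \<le> N" "2 * K + d \<le> card B"
    and E: "\<And>a b. a \<in> A \<Longrightarrow> b \<in> B \<Longrightarrow> {\<omega> \<in> space M. E a b \<omega>} \<in> events"
    and no_edge: "\<And>S U. S \<subseteq> A \<Longrightarrow> U \<subseteq> B \<Longrightarrow>
      prob {\<omega> \<in> space M. \<forall>a\<in>S. \<forall>b\<in>U. \<not> E a b \<omega>} \<le> q ^ (card S * card U)"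
    and q: "0 \<le> q" "q \<le> 1" and \<delta>: "real N ^ 3 * q ^ d \<le> \<delta>" "\<delta> \<le> 1"
  obtains Z where "Z \<in> events" "prob Z \<le> real K * \<delta>"
    "\<And>\<omega> S. \<omega> \<in> space M - Z \<Longrightarrow> S \<subseteq> A \<Longrightarrow> 1 \<le> card S \<Longrightarrow> card S \<le> K \<Longrightarrow>
       2 * card S \<le> card {b \<in> B. \<exists>a\<in>S. E a b \<omega>}"
proof
  define P where "P s = {S. S \<subseteq> A \<and> card S = s}" for s
  define Q where "Q s = {T. T \<subseteq> B \<and> card T = 2 * s}" for s
  define D where "D S T = {\<omega> \<in> space M. \<forall>a\<in>S. \<forall>b\<in>B - T. \<not> E a b \<omega>}" for S T
  define Z where "Z = (\<Union>s\<in>{1..K}. \<Union>S\<in>P s. \<Union>T\<in>Q s. D S T)"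
  have finP: "finite (P s)" and finQ: "finite (Q s)" for s
    using fin by (auto simp: P_def Q_def)
  have D: "D S T \<in> events" if "S \<subseteq> A" for S T
  proof -
    have "D S T = space M - (\<Union>a\<in>S. \<Union>b\<in>B - T. {\<omega> \<in> space M. E a b \<omega>})"
      by (auto simp: D_def)
    also have "\<dots> \<in> events"
      using that fin E by (intro sets.compl_sets sets.finite_UN) (auto intro: finite_subset)
    finally show ?thesis .
  qed
  have ev_T: "(\<Union>T\<in>Q s. D S T) \<in> events" if "S \<in> P s" for S s
    using that D by (intro sets.finite_UN[OF finQ]) (auto simp: P_def)
  have ev_S: "(\<Union>S\<in>P s. \<Union>T\<in>Q s. D S T) \<in> events" for s
    by (rule sets.finite_UN[OF finP ev_T])
  show "Z \<in> events"
    unfolding Z_def using ev_S by (intro sets.finite_UN[OF finite_atLeastAtMost])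
  have "prob Z \<le> (\<Sum>s\<in>{1..K}. prob (\<Union>S\<in>P s. \<Union>T\<in>Q s. D S T))"
    unfolding Z_def using ev_S by (intro finite_measure_subadditive_finite) auto
  also have "\<dots> \<le> (\<Sum>s\<in>{1..K}. \<delta>)"
  proof (rule sum_mono)
    fix s assume s: "s \<in> {1..K}"
    have "prob (\<Union>S\<in>P s. \<Union>T\<in>Q s. D S T) \<le> (\<Sum>S\<in>P s. prob (\<Union>T\<in>Q s. D S T))"
      using ev_T finP by (intro finite_measure_subadditive_finite) auto
    also have "\<dots> \<le> (\<Sum>S\<in>P s. \<Sum>T\<in>Q s. prob (D S T))"
      using finQ D by (intro sum_mono finite_measure_subadditive_finite) (auto simp: P_def)
    also have "\<dots> \<le> (\<Sum>S\<in>P s. \<Sum>T\<in>Q s. q ^ (s * d))"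
    proof (intro sum_mono)
      fix S T assume S: "S \<in> P s" and T: "T \<in> Q s"
      \<comment> \<open>As \<open>s \<le> K\<close>, at least \<open>d\<close> vertices remain
        outside \<open>T\<close>.\<close>
      have "card (B - T) = card B - 2 * s"
        using T fin by (auto simp: Q_def card_Diff_subset finite_subset)
      then have le: "s * d \<le> card S * card (B - T)"
        using S s card(3) by (auto simp: P_def)
      have "prob (D S T) \<le> q ^ (card S * card (B - T))"
        unfolding D_def using S by (intro no_edge) (auto simp: P_def)
      also have "\<dots> \<le> q ^ (s * d)" using le q by (intro power_decreasing) auto
      finally show "prob (D S T) \<le> q ^ (s * d)" .
    qed
    also have "\<dots> = real (card A choose s) * real (card B choose (2 * s)) * q ^ (s * d)"
      using fin by (simp add: P_def Q_def n_subsets)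
    \<comment> \<open>Each element of \<open>S\<close> costs one factor \<open>N\<close> for
      choosing \<open>S\<close> and two for choosing \<open>T\<close>, and gains
      \<open>q ^ d\<close>; this is why \<open>real N ^ 3 * q ^ d\<close> is the controlled
      quantity. Its power \<open>s\<close> is then bounded crudely by \<open>\<delta>\<close>, as
      \<open>s \<ge> 1\<close> and \<open>\<delta> \<le> 1\<close>.\<close>
    also have "\<dots> \<le> real N ^ s * real N ^ (2 * s) * q ^ (s * d)"
    proof -
      have ch: "real (m choose r) \<le> real N ^ r" if "m \<le> N" for m r
      proof (cases "r \<le> m")
        case True
        then have "real (m choose r) \<le> real (m ^ r)"
          using binomial_le_pow by (simp only: of_nat_le_iff)
        also have "\<dots> \<le> real N ^ r" using that by (simp add: power_mono)
        finally show ?thesis .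
      qed (simp add: binomial_eq_0)
      show ?thesis using card q by (intro mult_mono ch) auto
    qed
    also have "\<dots> = (real N ^ 3 * q ^ d) ^ s"
      by (simp add: power_mult_distrib mult.commute flip: power_mult power_add)
    also have "\<dots> \<le> \<delta> ^ s" using q \<delta> by (intro power_mono) auto
    also have "\<dots> \<le> \<delta> ^ 1"
    proof (rule power_decreasing)
      have "0 \<le> real N ^ 3 * q ^ d" using q by simp
      then show "0 \<le> \<delta>" using \<delta> by linarith
    qed (use s \<delta> in auto)
    finally show "prob (\<Union>S\<in>P s. \<Union>T\<in>Q s. D S T) \<le> \<delta>" by simp
  qed
  finally show "prob Z \<le> real K * \<delta>" by simp
  fix \<omega> S assume A: "\<omega> \<in> space M - Z" "S \<subseteq> A" "1 \<le> card S" "card S \<le> K"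
  let ?N = "{b \<in> B. \<exists>a\<in>S. E a b \<omega>}"
  show "2 * card S \<le> card ?N"
  proof (rule ccontr)
    assume "\<not> 2 * card S \<le> card ?N"
    then have "card ?N \<le> 2 * card S" "2 * card S \<le> card B" "?N \<subseteq> B"
      using A card by auto
    then obtain T where T: "?N \<subseteq> T" "T \<subseteq> B" "card T = 2 * card S"
      using exists_subset_between[of ?N "2 * card S" B] fin(2) by blast
    have "\<omega> \<in> D S T" using T A by (auto simp: D_def)
    then show False using A T by (auto simp: Z_def P_def Q_def)
  qed
qed

section \<open>Approximate law of one price\<close>

text \<open>The support condition alone allows an atom at 0; the density excludes it. The function
  \<open>g\<close> vanishes almost everywhere on half-lines exhausting the negative reals, and
  \<open>{0}\<close> is a null set. This makes the values almost surely positive.\<close>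

lemma cdf_with_density_at_0:
  assumes "cdf_supported_on_unit_interval G" "cdf_has_density G g"
  shows "G 0 = 0"
proof -
  have g: "integrable lborel g" "\<And>x. 0 \<le> g x" "\<And>x. G x = (LINT t:{..x}|lborel. g t)"
    using assms by (auto simp: cdf_has_density_def)
  have "AE t in lborel. indicator {..- inverse (real (Suc n))} t *\<^sub>R g t = 0" for n
  proof (subst integral_nonneg_eq_0_iff_AE[symmetric])
    show "integrable lborel (\<lambda>t. indicator {..- inverse (real (Suc n))} t *\<^sub>R g t)"
      using g(1) by (intro integrable_mult_indicator) auto
    show "AE t in lborel. 0 \<le> indicator {..- inverse (real (Suc n))} t *\<^sub>R g t"
      using g(2) by auto
    have "- inverse (real (Suc n)) < 0" by simp
    then have "G (- inverse (real (Suc n))) = 0"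
      using assms unfolding cdf_supported_on_unit_interval_def by blast
    then show "(LINT t|lborel. indicator {..- inverse (real (Suc n))} t *\<^sub>R g t) = 0"
      using g(3) by (simp add: set_lebesgue_integral_def)
  qed
  then have "AE t in lborel. \<forall>n. indicator {..- inverse (real (Suc n))} t *\<^sub>R g t = 0"
    by (rule iffD2[OF AE_all_countable, OF allI])
  moreover have "AE t in lborel. t \<noteq> (0::real)" by (rule AE_lborel_singleton)
  ultimately have "AE t in lborel. indicator {..0} t *\<^sub>R g t = 0"
  proof eventually_elim
    case (elim t)
    show ?case
    proof (cases "t < 0")
      case True
      then obtain n where "inverse (real (Suc n)) < - t"
        using reals_Archimedean[of "- t"] by auto
      then have "t \<le> - inverse (real (Suc n))" by simp
      then show ?thesis using elim(1) by (auto simp: indicator_def split: if_splits)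
    qed (use elim in auto)
  qed
  then have "(LINT t|lborel. indicator {..0} t *\<^sub>R g t) = 0"
    by (rule integral_eq_zero_AE)
  then show ?thesis using g(3) by (simp add: set_lebesgue_integral_def)
qed

text \<open>Cutting the total mass 1 at \<open>1 - \<epsilon>\<close> leaves an interval of length
  \<open>\<epsilon>\<close> on which the density is at least \<open>\<gamma>\<close>. So a pair is
  joined with probability at least \<open>\<gamma> * \<epsilon>\<close>.\<close>

lemma cdf_with_density_upper_tail:
  assumes "cdf_supported_on_unit_interval G" "cdf_has_density G g"
    and low: "\<And>x. x \<in> {0..1} \<Longrightarrow> \<gamma> \<le> g x" and \<epsilon>: "0 \<le> \<epsilon>" "\<epsilon> \<le> 1"
  shows "G (1 - \<epsilon>) \<le> 1 - \<gamma> * \<epsilon>"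
proof -
  have g: "integrable lborel g" "\<And>x. 0 \<le> g x" "\<And>x. G x = (LINT t:{..x}|lborel. g t)"
    using assms by (auto simp: cdf_has_density_def)
  have si: "set_integrable lborel A g" if "A \<in> sets borel" for A
    unfolding set_integrable_def using g(1) that by (intro integrable_mult_indicator) auto
  have "G 1 = (LINT t:{..1 - \<epsilon>} \<union> {1 - \<epsilon><..1}|lborel. g t)"
    using g(3) \<epsilon> by (simp add: ivl_disj_un)
  also have "\<dots> = G (1 - \<epsilon>) + (LINT t:{1 - \<epsilon><..1}|lborel. g t)"
    unfolding g(3) by (intro set_integral_Un si) auto
  finally have "G 1 = G (1 - \<epsilon>) + (LINT t:{1 - \<epsilon><..1}|lborel. g t)" .
  moreover have "(LINT t:{1 - \<epsilon><..1}|lborel. \<gamma>) \<le> (LINT t:{1 - \<epsilon><..1}|lborel. g t)"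
    using low \<epsilon> by (intro set_integral_mono si) (auto simp: set_integrable_def)
  moreover have "(LINT t:{1 - \<epsilon><..1}|lborel. \<gamma>) = \<gamma> * \<epsilon>"
    using \<epsilon> by (simp add: set_lebesgue_integral_def)
  moreover have "G 1 = 1"
    using assms(1) by (simp add: cdf_supported_on_unit_interval_def)
  ultimately show ?thesis by linarith
qed

text \<open>For fixed \<open>n\<close>: outside an expansion failure of probability at most
  \<open>8 / real n ^ 2\<close> and a null set of matrices with entries not in the interval (0,1],
  the deterministic spread bounds apply to every core allocation.\<close>

lemma (in prob_space) core_spread_prob:
  fixes \<alpha> :: "nat \<Rightarrow> nat \<Rightarrow> 'a \<Rightarrow> real" and n m L :: nat and \<gamma> \<epsilon> b :: real
  assumes iid: "iid_with_cdf M ({1..n} \<times> {1..m}) (\<lambda>(i, j). \<alpha> i j) G"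
    and G: "cdf_supported_on_unit_interval G" "cdf_has_density G g"
    and low: "\<And>x. x \<in> {0..1} \<Longrightarrow> \<gamma> \<le> g x" and n: "12 \<le> n" "n \<le> m"
    and \<epsilon>: "0 \<le> \<epsilon>" "\<epsilon> \<le> 1" "24 * ln (real n) / real n \<le> \<gamma> * \<epsilon>"
    and L: "2 * n \<le> 2 ^ L" and b: "real (2 * L + 2) * \<epsilon> \<le> b"
  shows "1 - prob {\<omega> \<in> space M. \<forall>(\<mu>, u, v) \<in> core {1..n} {1..m} (\<lambda>i j. \<alpha> i j \<omega>).
      (\<forall>i\<in>{1..n}. \<forall>j\<in>{1..n}. \<bar>u i - u j\<bar> \<le> b) \<and>
      (\<forall>i\<in>{1..m}. \<forall>j\<in>{1..m}. \<bar>v i - v j\<bar> \<le> b)} \<le> 8 / real n ^ 2" (is "1 - prob ?T \<le> _")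
proof -
  have indep: "indep_vars (\<lambda>_. borel) (\<lambda>(i, j). \<alpha> i j) ({1..n} \<times> {1..m})"
    and cdf: "\<And>i j. i \<in> {1..n} \<Longrightarrow> j \<in> {1..m} \<Longrightarrow> cdf (distr M borel (\<alpha> i j)) = G"
    using iid by (auto simp: iid_with_cdf_def)
  have meas: "\<alpha> i j \<in> borel_measurable M" if "i \<in> {1..n}" "j \<in> {1..m}" for i j
    using indep that by (auto simp: indep_vars_def)
  have prob_le: "prob {\<omega> \<in> space M. \<alpha> i j \<omega> \<le> t} = G t" if "i \<in> {1..n}" "j \<in> {1..m}" for i j t
  proof -
    have "cdf (distr M borel (\<alpha> i j)) t = prob (\<alpha> i j -` {..t} \<inter> space M)"
      using meas[OF that] by (simp add: cdf_def2 measure_distr)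
    also have "\<alpha> i j -` {..t} \<inter> space M = {\<omega> \<in> space M. \<alpha> i j \<omega> \<le> t}" by auto
    finally show ?thesis using cdf[OF that] by simp
  qed
  \<comment> \<open>The probability that a given pair is not joined.\<close>
  define q where "q = G (1 - \<epsilon>)"
  \<comment> \<open>A third of the firms: \<open>3 * d \<le> n\<close> leaves \<open>d\<close>
    vertices outside a set of size \<open>2 * d\<close>, and \<open>n < 4 * d\<close>, from
    \<open>n \<ge> 12\<close>, makes two level sets of that size intersect.\<close>
  define d where "d = n div 3"
  \<comment> \<open>This is the cube of \<open>2 * n\<close>, which bounds both sides of every graph
    considered, times the bound \<open>inverse (real n ^ 6)\<close> for
    \<open>q ^ d\<close>.\<close>
  define \<delta> where "\<delta> = 8 / real n ^ 3"
  have q: "0 \<le> q" "q \<le> 1" "q \<le> 1 - \<gamma> * \<epsilon>"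
  proof -
    have q_eq: "q = prob {\<omega> \<in> space M. \<alpha> 1 1 \<omega> \<le> 1 - \<epsilon>}"
      unfolding q_def using n by (subst prob_le) auto
    then show "0 \<le> q" "q \<le> 1" by simp_all
    show "q \<le> 1 - \<gamma> * \<epsilon>"
      unfolding q_def by (rule cdf_with_density_upper_tail[OF G low \<epsilon>(1,2)])
  qed
  have edge: "{\<omega> \<in> space M. 1 - \<epsilon> < \<alpha> i j \<omega>} \<in> events" if "i \<in> {1..n}" "j \<in> {1..m}" for i j
  proof -
    have [measurable]: "\<alpha> i j \<in> borel_measurable M" by (rule meas[OF that])
    show ?thesis by measurable
  qed
  have no_edge: "prob {\<omega> \<in> space M. \<forall>a\<in>S. \<forall>b\<in>U. \<not> 1 - \<epsilon> < \<alpha> a b \<omega>} \<le> q ^ (card S * card U)"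
    if "S \<subseteq> {1..n}" "U \<subseteq> {1..m}" for S U
  proof -
    have "prob {\<omega> \<in> space M. \<forall>i\<in>S \<times> U. (\<lambda>(i, j). \<alpha> i j) i \<omega> \<le> 1 - \<epsilon>} \<le> q ^ card (S \<times> U)"
    proof (rule indep_vars_prob_all_le[OF indep])
      show "S \<times> U \<subseteq> {1..n} \<times> {1..m}" "finite (S \<times> U)"
        using that by (auto intro: finite_subset)
      fix x assume "x \<in> S \<times> U"
      then have "fst x \<in> {1..n}" "snd x \<in> {1..m}" using that by auto
      then show "cdf (distr M borel ((\<lambda>(i, j). \<alpha> i j) x)) (1 - \<epsilon>) \<le> q"
        unfolding q_def case_prod_unfold using cdf by simp
    qed
    moreover have "{\<omega> \<in> space M. \<forall>i\<in>S \<times> U. (\<lambda>(i, j). \<alpha> i j) i \<omega> \<le> 1 - \<epsilon>} =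
        {\<omega> \<in> space M. \<forall>a\<in>S. \<forall>b\<in>U. \<not> 1 - \<epsilon> < \<alpha> a b \<omega>}"
      by (auto simp: not_less)
    ultimately show ?thesis by (simp add: card_cartesian_product)
  qed
  have no_edge': "prob {\<omega> \<in> space M. \<forall>b\<in>U. \<forall>a\<in>S. \<not> 1 - \<epsilon> < \<alpha> a b \<omega>} \<le> q ^ (card U * card S)"
    if "U \<subseteq> {1..m}" "S \<subseteq> {1..n}" for S U
  proof -
    have "{\<omega> \<in> space M. \<forall>b\<in>U. \<forall>a\<in>S. \<not> 1 - \<epsilon> < \<alpha> a b \<omega>} =
      {\<omega> \<in> space M. \<forall>a\<in>S. \<forall>b\<in>U. \<not> 1 - \<epsilon> < \<alpha> a b \<omega>}" by auto
    then show ?thesis using no_edge[OF that(2,1)] by (simp only: mult.commute[of "card U"])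
  qed
  have \<delta>: "real (2 * n) ^ 3 * q ^ d \<le> \<delta>" "\<delta> \<le> 1"
  proof -
    have "q ^ d \<le> exp (- (\<gamma> * \<epsilon>)) ^ d"
      using q exp_ge_add_one_self[of "- (\<gamma> * \<epsilon>)"] by (intro power_mono) auto
    also have "\<dots> = exp (- (real d * (\<gamma> * \<epsilon>)))" by (simp flip: exp_of_nat_mult)
    also have "\<dots> \<le> exp (- (6 * ln (real n)))"
    proof -
      \<comment> \<open>From \<open>n \<ge> 12\<close> one gets \<open>d \<ge> n / 4\<close>, which
        turns the constant 24 into the exponent 6.\<close>
      have "real n / 4 * (24 * ln (real n) / real n) \<le> real d * (\<gamma> * \<epsilon>)"
        using n \<epsilon>(3) by (intro mult_mono) (auto simp: d_def)
      then show ?thesis using n by simp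
    qed
    also have "\<dots> = inverse (real n ^ 6)"
      using n exp_of_nat_mult[of 6 "ln (real n)"] by (simp add: exp_minus)
    finally have "real (2 * n) ^ 3 * q ^ d \<le> real (2 * n) ^ 3 * inverse (real n ^ 6)"
      by (intro mult_left_mono) auto
    also have "\<dots> = \<delta>" using n by (simp add: \<delta>_def field_simps flip: power_add)
    finally show "real (2 * n) ^ 3 * q ^ d \<le> \<delta>" .
    have "(2::real) ^ 3 \<le> real n ^ 3" using n by (intro power_mono) auto
    then show "\<delta> \<le> 1" using n by (simp add: \<delta>_def field_simps)
  qed
  have \<delta>0: "0 \<le> \<delta>" by (simp add: \<delta>_def)
  have sum_le: "x \<le> 8 / real n ^ 2" if "x \<le> real (2 * d) * \<delta>" for x
  proof -
    have "real (2 * d) * \<delta> \<le> real n * \<delta>" using \<delta>0 by (intro mult_right_mono) (auto simp: d_def)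
    also have "\<dots> = 8 / real n ^ 2" using n by (simp add: \<delta>_def power3_eq_cube power2_eq_square)
    finally show ?thesis using that by simp
  qed
  have dn: "n < 4 * d" "3 * d \<le> n" using n by (auto simp: d_def)
  obtain Z where Z: "Z \<in> events" "prob Z \<le> 8 / real n ^ 2"
    and spread: "\<And>\<omega> \<mu> u v. \<omega> \<in> space M - Z \<Longrightarrow> (\<forall>i\<in>{1..n}. \<forall>j\<in>{1..m}. 0 < \<alpha> i j \<omega> \<and> \<alpha> i j \<omega> \<le> 1) \<Longrightarrow>
      (\<mu>, u, v) \<in> core {1..n} {1..m} (\<lambda>i j. \<alpha> i j \<omega>) \<Longrightarrow>
      (\<forall>i\<in>{1..n}. \<forall>j\<in>{1..n}. \<bar>u i - u j\<bar> \<le> b) \<and> (\<forall>i\<in>{1..m}. \<forall>j\<in>{1..m}. \<bar>v i - v j\<bar> \<le> b)"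
  proof (cases "m \<le> 2 * n")
    case True
    obtain Z1 where Z1: "Z1 \<in> events" "prob Z1 \<le> real d * \<delta>"
      and expand1: "\<And>\<omega> S. \<omega> \<in> space M - Z1 \<Longrightarrow> S \<subseteq> {1..n} \<Longrightarrow> 1 \<le> card S \<Longrightarrow> card S \<le> d \<Longrightarrow>
       2 * card S \<le> card {b \<in> {1..m}. \<exists>a\<in>S. 1 - \<epsilon> < \<alpha> a b \<omega>}"
      by (rule random_graph_expansion[where A = "{1..n}" and B = "{1..m}" and K = d and
          E = "\<lambda>a b \<omega>. 1 - \<epsilon> < \<alpha> a b \<omega>", OF _ _ _ _ _ edge no_edge q(1,2) \<delta>]) (use True n dn in auto)
    obtain Z2 where Z2: "Z2 \<in> events" "prob Z2 \<le> real d * \<delta>"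
      and expand2: "\<And>\<omega> S. \<omega> \<in> space M - Z2 \<Longrightarrow> S \<subseteq> {1..m} \<Longrightarrow> 1 \<le> card S \<Longrightarrow> card S \<le> d \<Longrightarrow>
       2 * card S \<le> card {a \<in> {1..n}. \<exists>b\<in>S. 1 - \<epsilon> < \<alpha> a b \<omega>}"
      by (rule random_graph_expansion[where A = "{1..m}" and B = "{1..n}" and K = d and
          E = "\<lambda>b a \<omega>. 1 - \<epsilon> < \<alpha> a b \<omega>", OF _ _ _ _ _ edge no_edge' q(1,2) \<delta>]) (use True n dn in auto)
    show thesis
    proof (rule that[of "Z1 \<union> Z2"])
      show "Z1 \<union> Z2 \<in> events" using Z1 Z2 by auto
      have "prob (Z1 \<union> Z2) \<le> prob Z1 + prob Z2"
        using Z1 Z2 by (intro measure_Un_le) auto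
      then show "prob (Z1 \<union> Z2) \<le> 8 / real n ^ 2"
        using Z1(2) Z2(2) by (intro sum_le) (simp add: algebra_simps)
      fix \<omega> \<mu> u v
      assume \<omega>: "\<omega> \<in> space M - (Z1 \<union> Z2)"
        and \<alpha>: "\<forall>i\<in>{1..n}. \<forall>j\<in>{1..m}. 0 < \<alpha> i j \<omega> \<and> \<alpha> i j \<omega> \<le> 1"
        and core: "(\<mu>, u, v) \<in> core {1..n} {1..m} (\<lambda>i j. \<alpha> i j \<omega>)"
      interpret stable_payoffs "{1..n}" "{1..m}" "\<lambda>i j. \<alpha> i j \<omega>" \<mu> u v
        by (rule core_imp_stable_payoffs[OF _ _ core]) auto
      have all: "fst ` \<mu> = {1..n}" using \<alpha> n by (intro all_firms_matched) auto
      have "(i \<in> {1..n} \<longrightarrow> j \<in> {1..n} \<longrightarrow> \<bar>u i - u j\<bar> \<le> real (2 * L + 2) * \<epsilon>) \<and>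
         (i' \<in> {1..m} \<longrightarrow> j' \<in> {1..m} \<longrightarrow> \<bar>v i' - v j'\<bar> \<le> real (2 * L + 2) * \<epsilon>)" for i j i' j'
        by (rule payoff_spread_balanced[OF _ all \<epsilon>(1) expand1 expand2])
          (use \<alpha> \<omega> dn L in auto)
      then show "(\<forall>i\<in>{1..n}. \<forall>j\<in>{1..n}. \<bar>u i - u j\<bar> \<le> b) \<and> (\<forall>i\<in>{1..m}. \<forall>j\<in>{1..m}. \<bar>v i - v j\<bar> \<le> b)"
        using b by (meson order_trans)
    qed
  next
    case False
    \<comment> \<open>Here \<open>m\<close> may be so large that some worker has no neighbour at all, hence no expansion of worker sets.\<close>
    have edge': "{\<omega> \<in> space M. 1 - \<epsilon> < \<alpha> i j \<omega>} \<in> events" if "i \<in> {1..n}" "j \<in> {1..2 * n}" for i j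
      using edge that False by auto
    have no_edge'': "prob {\<omega> \<in> space M. \<forall>a\<in>S. \<forall>b\<in>U. \<not> 1 - \<epsilon> < \<alpha> a b \<omega>} \<le> q ^ (card S * card U)"
      if "S \<subseteq> {1..n}" "U \<subseteq> {1..2 * n}" for S U
    proof (rule no_edge[OF that(1)])
      show "U \<subseteq> {1..m}" using that(2) False by auto
    qed
    \<comment> \<open>Against \<open>2 * n\<close> workers there is room for
      \<open>K = 2 * d\<close>, since \<open>5 * d \<le> 2 * n\<close>; then
      \<open>2 * K = 4 * d\<close> exceeds the number of firms, as the unbalanced bound
      requires.\<close>
    obtain Z where Z: "Z \<in> events" "prob Z \<le> real (2 * d) * \<delta>"
      and expand: "\<And>\<omega> S. \<omega> \<in> space M - Z \<Longrightarrow> S \<subseteq> {1..n} \<Longrightarrow> 1 \<le> card S \<Longrightarrow> card S \<le> 2 * d \<Longrightarrow>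
       2 * card S \<le> card {b \<in> {1..2 * n}. \<exists>a\<in>S. 1 - \<epsilon> < \<alpha> a b \<omega>}"
      by (rule random_graph_expansion[where A = "{1..n}" and B = "{1..2 * n}" and K = "2 * d" and
          E = "\<lambda>a b \<omega>. 1 - \<epsilon> < \<alpha> a b \<omega>", OF _ _ _ _ _ edge' no_edge'' q(1,2) \<delta>])
        (use n dn in auto)
    show thesis
    proof (rule that[of Z])
      show "Z \<in> events" "prob Z \<le> 8 / real n ^ 2" using Z sum_le by auto
      fix \<omega> \<mu> u v
      assume \<omega>: "\<omega> \<in> space M - Z"
        and \<alpha>: "\<forall>i\<in>{1..n}. \<forall>j\<in>{1..m}. 0 < \<alpha> i j \<omega> \<and> \<alpha> i j \<omega> \<le> 1"
        and core: "(\<mu>, u, v) \<in> core {1..n} {1..m} (\<lambda>i j. \<alpha> i j \<omega>)"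
      interpret stable_payoffs "{1..n}" "{1..m}" "\<lambda>i j. \<alpha> i j \<omega>" \<mu> u v
        by (rule core_imp_stable_payoffs[OF _ _ core]) auto
      have "(i \<in> {1..n} \<longrightarrow> j \<in> {1..n} \<longrightarrow> \<bar>u i - u j\<bar> \<le> real (L + 1) * \<epsilon>) \<and>
         (i' \<in> {1..m} \<longrightarrow> j' \<in> {1..m} \<longrightarrow> \<bar>v i' - v j'\<bar> \<le> real (L + 1) * \<epsilon>)" for i j i' j'
        by (rule payoff_spread_unbalanced[where K = "2 * d", OF _ _ \<epsilon>(1) expand])
          (use \<alpha> \<omega> dn L False in auto)
      moreover have "real (L + 1) * \<epsilon> \<le> real (2 * L + 2) * \<epsilon>"
        using \<epsilon>(1) by (intro mult_right_mono) auto
      then have "real (L + 1) * \<epsilon> \<le> b" using b by linarith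
      ultimately show "(\<forall>i\<in>{1..n}. \<forall>j\<in>{1..n}. \<bar>u i - u j\<bar> \<le> b) \<and> (\<forall>i\<in>{1..m}. \<forall>j\<in>{1..m}. \<bar>v i - v j\<bar> \<le> b)"
        by (meson order_trans)
    qed
  qed
  \<comment> \<open>The upper bound 1 drives the spread estimates; strict positivity matches all
    firms in the balanced case.\<close>
  have "AE \<omega> in M. 0 < \<alpha> i j \<omega> \<and> \<alpha> i j \<omega> \<le> 1" if ij: "i \<in> {1..n}" "j \<in> {1..m}" for i j
  proof -
    have [measurable]: "\<alpha> i j \<in> borel_measurable M" by (rule meas[OF ij])
    have "prob {\<omega> \<in> space M. \<alpha> i j \<omega> \<le> 0} = 0"
      using prob_le[OF ij] cdf_with_density_at_0[OF G] by simp
    then have "AE \<omega> in M. \<omega> \<notin> {\<omega> \<in> space M. \<alpha> i j \<omega> \<le> 0}"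
      by (intro AE_not_in) (auto simp: null_sets_def emeasure_eq_measure)
    moreover have "prob {\<omega> \<in> space M. \<alpha> i j \<omega> \<le> 1} = 1"
      using prob_le[OF ij] G(1) by (simp add: cdf_supported_on_unit_interval_def)
    then have "AE \<omega> in M. \<omega> \<in> {\<omega> \<in> space M. \<alpha> i j \<omega> \<le> 1}"
      by (intro AE_in_set_eq_1[THEN iffD2]) auto
    ultimately show ?thesis
      using AE_space by eventually_elim auto
  qed
  then have "AE \<omega> in M. \<forall>i\<in>{1..n}. \<forall>j\<in>{1..m}. 0 < \<alpha> i j \<omega> \<and> \<alpha> i j \<omega> \<le> 1"
    by (intro AE_finite_allI) auto
  then obtain N where N: "N \<in> events" "emeasure M N = 0"
    and N': "{\<omega> \<in> space M. \<not> (\<forall>i\<in>{1..n}. \<forall>j\<in>{1..m}. 0 < \<alpha> i j \<omega> \<and> \<alpha> i j \<omega> \<le> 1)} \<subseteq> N"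
    by (rule AE_E)
  have T: "?T \<in> events"
    by (intro core_payoff_spread_measurable meas) auto
  have "space M - ?T \<subseteq> Z \<union> N"
  proof
    fix \<omega> assume \<omega>: "\<omega> \<in> space M - ?T"
    show "\<omega> \<in> Z \<union> N"
    proof (rule ccontr)
      assume "\<omega> \<notin> Z \<union> N"
      then have "\<forall>i\<in>{1..n}. \<forall>j\<in>{1..m}. 0 < \<alpha> i j \<omega> \<and> \<alpha> i j \<omega> \<le> 1" "\<omega> \<in> space M - Z"
        using N' \<omega> by auto
      then have "\<omega> \<in> ?T" using spread \<omega> by blast
      then show False using \<omega> by blast
    qed
  qed
  then have "prob (space M - ?T) \<le> prob (Z \<union> N)"
    using Z N by (intro finite_measure_mono) auto
  also have "\<dots> \<le> prob Z + prob N" using Z N by (intro measure_Un_le) auto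
  also have "prob N = 0" using N by (simp add: measure_def)
  finally show ?thesis using Z(2) prob_compl[OF T] by simp
qed

theorem theorem1:
  fixes \<Omega> :: "nat \<Rightarrow> 'a measure"
    and k :: "nat \<Rightarrow> nat"
    and \<alpha> :: "nat \<Rightarrow> nat \<Rightarrow> nat \<Rightarrow> 'a \<Rightarrow> real"
    and G g :: "real \<Rightarrow> real"
  assumes "\<And>n. n \<ge> 1 \<Longrightarrow> prob_space (\<Omega> n)"
    and "\<And>n. n \<ge> 1 \<Longrightarrow> iid_with_cdf (\<Omega> n) ({1..n} \<times> {1..n + k n}) (\<lambda>(i, j). \<alpha> n i j) G"
    and "cdf_supported_on_unit_interval G"
    and "cdf_has_density G g"
    and "continuous_on {0..1} g"
    and "\<And>x. x \<in> {0..1} \<Longrightarrow> 0 < g x"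
  shows "\<exists>c\<ge>0.
    (\<lambda>n. 1 - measure (\<Omega> n) {\<omega> \<in> space (\<Omega> n).
        \<forall>(\<mu>, u, v) \<in> core {1..n} {1..n + k n} (\<lambda>i j. \<alpha> n i j \<omega>).
          (\<forall>i\<in>{1..n}. \<forall>j\<in>{1..n}. \<bar>u i - u j\<bar> \<le> c * (ln (real n))\<^sup>2 / real n) \<and>
          (\<forall>i\<in>{1..n + k n}. \<forall>j\<in>{1..n + k n}. \<bar>v i - v j\<bar> \<le> c * (ln (real n))\<^sup>2 / real n)})
      \<in> O(\<lambda>n. 1 / real n)"
proof -
  \<comment> \<open>Compactness turns pointwise positivity of the density into a uniform lower bound
    \<open>\<gamma>\<close>.\<close>
  obtain x0 where x0: "x0 \<in> {0..1}" "\<And>x. x \<in> {0..1} \<Longrightarrow> g x0 \<le> g x"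
    using continuous_attains_inf[OF compact_Icc _ assms(5)] by auto
  define \<gamma> where "\<gamma> = g x0"
  have \<gamma>: "0 < \<gamma>" using assms(6) x0 by (simp add: \<gamma>_def)
  \<comment> \<open>The product of the 24 in \<open>\<epsilon>\<close> below and the 10 in
    \<open>2 * L + 2 \<le> 10 * ln (real n)\<close>, which follows from \<open>L_le\<close> and
    \<open>ln1\<close>.\<close>
  define c where "c = 240 / \<gamma>"
  have lim: "(\<lambda>n. ln (real n) / real n) \<longlonglongrightarrow> 0"
    using lim_ln_over_n by simp
  \<comment> \<open>Ensures \<open>\<epsilon> \<le> 1\<close>, so that the threshold
    \<open>1 - \<epsilon>\<close> stays in the unit interval.\<close>
  have "eventually (\<lambda>n. ln (real n) / real n < \<gamma> / 24) sequentially"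
    using order_tendstoD(2)[OF lim, of "\<gamma> / 24"] \<gamma> by simp
  then have "eventually (\<lambda>n. norm (1 - measure (\<Omega> n) {\<omega> \<in> space (\<Omega> n).
        \<forall>(\<mu>, u, v) \<in> core {1..n} {1..n + k n} (\<lambda>i j. \<alpha> n i j \<omega>).
          (\<forall>i\<in>{1..n}. \<forall>j\<in>{1..n}. \<bar>u i - u j\<bar> \<le> c * (ln (real n))\<^sup>2 / real n) \<and>
          (\<forall>i\<in>{1..n + k n}. \<forall>j\<in>{1..n + k n}. \<bar>v i - v j\<bar> \<le> c * (ln (real n))\<^sup>2 / real n)})
      \<le> 8 * norm (1 / real n)) sequentially"
    using eventually_ge_at_top[of 12]
  proof eventually_elim
    case (elim n)
    interpret prob_space "\<Omega> n" using assms(1) elim by simp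
    define \<epsilon> where "\<epsilon> = 24 * ln (real n) / (\<gamma> * real n)"
    define L where "L = nat \<lceil>log 2 (real (2 * n))\<rceil>"
    have ln1: "1 \<le> ln (real n)"
      using exp_le elim by (subst ln_ge_iff) auto
    have L: "2 * n \<le> 2 ^ L"
    proof -
      have "real (2 * n) = 2 powr log 2 (real (2 * n))" using elim by simp
      also have "\<dots> \<le> 2 powr real L" unfolding L_def by (intro powr_mono) linarith+
      also have "\<dots> = real (2 ^ L)" by (simp add: powr_realpow)
      finally show ?thesis by (simp only: of_nat_le_iff)
    qed
    \<comment> \<open>One unit comes from the factor 2 in \<open>2 * n\<close> and one from rounding
      up; \<open>ln 2 \<ge> 1 / 2\<close> gives the coefficient 2.\<close>
    have L_le: "real L \<le> 2 + 2 * ln (real n)"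
    proof -
      have "log 2 (real (2 * n)) = 1 + ln (real n) / ln 2"
        using elim by (simp add: log_def ln_mult add_divide_distrib)
      also have "ln (real n) / ln 2 \<le> ln (real n) / (1 / 2)"
        using ln1 ln2_ge_two_thirds by (intro divide_left_mono) auto
      finally have "log 2 (real (2 * n)) \<le> 1 + 2 * ln (real n)" by simp
      moreover have "0 \<le> log 2 (real (2 * n))" using elim by (intro zero_le_log_cancel_iff[THEN iffD2]) auto
      ultimately show ?thesis unfolding L_def by linarith
    qed
    have "1 - prob {\<omega> \<in> space (\<Omega> n).
        \<forall>(\<mu>, u, v) \<in> core {1..n} {1..n + k n} (\<lambda>i j. \<alpha> n i j \<omega>).
          (\<forall>i\<in>{1..n}. \<forall>j\<in>{1..n}. \<bar>u i - u j\<bar> \<le> c * (ln (real n))\<^sup>2 / real n) \<and>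
          (\<forall>i\<in>{1..n + k n}. \<forall>j\<in>{1..n + k n}. \<bar>v i - v j\<bar> \<le> c * (ln (real n))\<^sup>2 / real n)}
      \<le> 8 / real n ^ 2"
    proof (rule core_spread_prob[OF assms(2) assms(3,4)])
      show "\<gamma> \<le> g x" if "x \<in> {0..1}" for x using x0 that by (simp add: \<gamma>_def)
      show "0 \<le> \<epsilon>" using \<gamma> ln1 by (simp add: \<epsilon>_def)
      show "\<epsilon> \<le> 1" using elim \<gamma> by (simp add: \<epsilon>_def field_simps)
      show "24 * ln (real n) / real n \<le> \<gamma> * \<epsilon>" using \<gamma> by (simp add: \<epsilon>_def)
      have "real (2 * L + 2) * \<epsilon> \<le> (10 * ln (real n)) * \<epsilon>"
        using L_le ln1 \<open>0 \<le> \<epsilon>\<close> by (intro mult_right_mono) auto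
      also have "\<dots> = c * (ln (real n))\<^sup>2 / real n"
        by (simp add: \<epsilon>_def c_def power2_eq_square)
      finally show "real (2 * L + 2) * \<epsilon> \<le> c * (ln (real n))\<^sup>2 / real n" .
    qed (use elim L in auto)
    also have "8 / real n ^ 2 \<le> 8 * norm (1 / real n)"
      using elim by (simp add: power2_eq_square field_simps)
    finally show ?case by simp
  qed
  then show ?thesis
    using \<gamma> by (intro exI[of _ c] conjI bigoI) (simp_all add: c_def)
qed

end
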